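(* Let $\mathcal B=(\mathbf x_n)_{n=1}^\infty$ be a semi-normalized Markushevich basis of a Banach space $\mathbb X$ over $\mathbb F=\mathbb R$ or $\mathbb C$. Then $\mathcal B$ is $1$-suppression unconditional if and only if $$\Vert f-\mathbf x_n^*(f)\mathbf x_n\Vert\le\Vert f\Vert\quad\text{for all } f\in\mathbb X \text{ and all } n\in\operatorname{supp}(f).$$
   Context: A sequence $\mathcal B=(\mathbf x_n)_{n=1}^\infty$ in a Banach space $\mathbb X$ is a semi-normalized Markushevich basis if: the closed linear span of $(\mathbf x_n)_n$ is $\mathbb X$; there is a unique sequence $(\mathbf x_n^* )_{n=1}^\infty\subset\mathbb X^*$ with $\mathbf x_n^*(\mathbf x_j)=\delta_{n,j}$; the weak$^*$-closed linear span of $(\mathbf x_n^* )_n$ is $\mathbb X^*$; and there are constants $c_1,c_2$ with $0<c_1\le \inf_n\{\Vert \mathbf x_n\Vert,\Vert\mathbf x_n^*\Vert\}\le\sup_n\{\Vert \mathbf x_n\Vert,\Vert\mathbf x_n^*\Vert\}\le c_2<\infty$. Write $\operatorname{supp}(f)=\{n\in\mathbb N:\mathbf x_n^*(f)\neq0\}$ and, for a finite set $A\subset\mathbb N$, $P_A(f)=\sum_{j\in A}\mathbf x_j^*(f)\mathbf x_j$. The basis is $1$-suppression unconditional if $\Vert f-P_A(f)\Vert\le\Vert f\Vert$ for all finite $A\subset\mathbb N$ and all $f\in\mathbb X$. *)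

theory Defs
  imports "HOL-Analysis.Analysis" "HOL-Library.Function_Algebras"
begin

text \<open>
  The scalar field is a type \<open>'k\<close> of class \<^class>\<open>real_normed_field\<close>. The norm of such a field
  is multiplicative, so by the Gelfand--Mazur theorem these are, up to isometric isomorphism,
  exactly \<^typ>\<open>real\<close> and \<^typ>\<open>complex\<close>. As the library's normed spaces only carry the real scalar
  multiplication \<^const>\<open>scaleR\<close>, the scalar multiplication by \<open>'k\<close> is a parameter \<open>smul\<close>,
  required to extend it. Completeness comes from the class \<^class>\<open>banach\<close>.
\<close>

locale normed_space_over = vector_space smul
  for smul :: "'k::real_normed_field \<Rightarrow> 'a::real_normed_vector \<Rightarrow> 'a" +
  assumes smul_of_real: "smul (of_real r) v = r *\<^sub>R v"
    and norm_smul: "norm (smul c v) = norm c * norm v"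

lemma normed_space_over_scaleR:
  "normed_space_over (scaleR :: real \<Rightarrow> 'a::real_normed_vector \<Rightarrow> 'a)"
  by unfold_locales (simp_all add: algebra_simps)

lemma normed_space_over_mult:
  "normed_space_over ((*) :: 'k \<Rightarrow> 'k \<Rightarrow> 'k::real_normed_field)"
  by unfold_locales (simp_all add: algebra_simps norm_mult scaleR_conv_of_real)

text \<open>
  The dual space, as a set of functions. Its norm is \<^const>\<open>onorm\<close>.
\<close>

definition dual_space ::
    "('k::real_normed_field \<Rightarrow> 'a::real_normed_vector \<Rightarrow> 'a) \<Rightarrow> ('a \<Rightarrow> 'k) set" where
  "dual_space smul = {\<phi>. bounded_linear \<phi> \<and> Vector_Spaces.linear smul (*) \<phi>}"

definition weak_star_topology ::
    "('k::real_normed_field \<Rightarrow> 'a::real_normed_vector \<Rightarrow> 'a) \<Rightarrow> ('a \<Rightarrow> 'k) topology" where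
  "weak_star_topology smul =
     topology_generated_by {{\<phi> \<in> dual_space smul. \<phi> v \<in> U} | v U. open U}"

definition biorthogonal ::
    "('k::real_normed_field \<Rightarrow> 'a::real_normed_vector \<Rightarrow> 'a) \<Rightarrow>
     (nat \<Rightarrow> 'a) \<Rightarrow> (nat \<Rightarrow> 'a \<Rightarrow> 'k) \<Rightarrow> bool" where
  "biorthogonal smul x xs \<longleftrightarrow>
     (\<forall>n. xs n \<in> dual_space smul) \<and> (\<forall>n j. xs n (x j) = (if n = j then 1 else 0))"

definition coord_functional ::
    "('k::real_normed_field \<Rightarrow> 'a::real_normed_vector \<Rightarrow> 'a) \<Rightarrow>
     (nat \<Rightarrow> 'a) \<Rightarrow> nat \<Rightarrow> 'a \<Rightarrow> 'k" where
  "coord_functional smul x = (THE xs. biorthogonal smul x xs)"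

definition seminormalized_Markushevich_basis ::
    "('k::real_normed_field \<Rightarrow> 'a::real_normed_vector \<Rightarrow> 'a) \<Rightarrow> (nat \<Rightarrow> 'a) \<Rightarrow> bool" where
  "seminormalized_Markushevich_basis smul x \<longleftrightarrow>
     closure (module.span smul (range x)) = UNIV \<and>
     (\<exists>!xs. biorthogonal smul x xs) \<and>
     weak_star_topology smul closure_of
       (module.span (\<lambda>c \<phi> v. c * \<phi> v) (range (coord_functional smul x))) = dual_space smul \<and>
     (\<exists>c1 c2. 0 < c1 \<and>
        (\<forall>n. c1 \<le> norm (x n) \<and> norm (x n) \<le> c2 \<and>
             c1 \<le> onorm (coord_functional smul x n) \<and>
             onorm (coord_functional smul x n) \<le> c2))"

definition supp ::
    "('k::real_normed_field \<Rightarrow> 'a::real_normed_vector \<Rightarrow> 'a) \<Rightarrow> (nat \<Rightarrow> 'a) \<Rightarrow> 'a \<Rightarrow> nat set" where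
  "supp smul x f = {n. coord_functional smul x n f \<noteq> 0}"

definition coord_proj ::
    "('k::real_normed_field \<Rightarrow> 'a::real_normed_vector \<Rightarrow> 'a) \<Rightarrow>
     (nat \<Rightarrow> 'a) \<Rightarrow> nat set \<Rightarrow> 'a \<Rightarrow> 'a" where
  "coord_proj smul x A f = (\<Sum>j\<in>A. smul (coord_functional smul x j f) (x j))"

definition one_suppression_unconditional ::
    "('k::real_normed_field \<Rightarrow> 'a::real_normed_vector \<Rightarrow> 'a) \<Rightarrow> (nat \<Rightarrow> 'a) \<Rightarrow> bool" where
  "one_suppression_unconditional smul x \<longleftrightarrow>
     (\<forall>A f. finite A \<longrightarrow> norm (f - coord_proj smul x A f) \<le> norm f)"

end

theory Submission
  imports Defs
begin

text \<open>
  Suppressing the coordinates of a finite set \<open>A\<close> amounts to suppressing them one at a time: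
  by biorthogonality, \<open>f - P\<^sub>A f\<close> still has the same \<open>n\<close>-th coordinate as \<open>f\<close> when
  \<open>n \<notin> A\<close>, so passing from \<open>A\<close> to \<open>A \<union> {n}\<close> removes from \<open>g = f - P\<^sub>A f\<close> its own
  \<open>n\<close>-th term \<open>x\<^sub>n\<^sup>*(g) x\<^sub>n\<close>. If this term is nonzero, the one-coordinate inequality at
  \<open>g\<close> applies; otherwise \<open>g\<close> is unchanged. Hence the norm never grows, and induction
  on \<open>A\<close> gives suppression unconditionality. The converse is the case of a singleton.
\<close>

lemma biorthogonal_coord_functional:
  assumes "seminormalized_Markushevich_basis smul x"
  shows "biorthogonal smul x (coord_functional smul x)"
proof -
  have "\<exists>!xs. biorthogonal smul x xs"
    using assms by (simp add: seminormalized_Markushevich_basis_def)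
  then show ?thesis
    unfolding coord_functional_def by (rule theI')
qed

lemma biorthogonal_coord_diff_sum:
  assumes "biorthogonal smul x xs" and "finite A" and "n \<notin> A"
  shows "xs n (f - (\<Sum>j\<in>A. smul (c j) (x j))) = xs n f"
proof -
  interpret lin: Vector_Spaces.linear smul "(*)" "xs n"
    using assms(1) by (simp add: biorthogonal_def dual_space_def)
  have "xs n (\<Sum>j\<in>A. smul (c j) (x j)) = (\<Sum>j\<in>A. c j * xs n (x j))"
    by (simp add: lin.sum lin.scale)
  also have "\<dots> = 0"
    using assms(1,3) by (intro sum.neutral) (auto simp: biorthogonal_def)
  finally show ?thesis by (simp add: lin.diff)
qed

lemma norm_diff_coord_proj_le:
  fixes smul :: "'k::real_normed_field \<Rightarrow> 'a::real_normed_vector \<Rightarrow> 'a"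
  assumes "vector_space smul"
    and bi: "biorthogonal smul x (coord_functional smul x)"
    and one: "\<And>f n. n \<in> supp smul x f \<Longrightarrow>
      norm (f - smul (coord_functional smul x n f) (x n)) \<le> norm f"
    and "finite A"
  shows "norm (f - coord_proj smul x A f) \<le> norm f"
  using \<open>finite A\<close>
proof induction
  case empty
  show ?case by (simp add: coord_proj_def)
next
  case (insert n A)
  interpret vector_space smul by fact
  define g where "g = f - coord_proj smul x A f"
  have "coord_functional smul x n g = coord_functional smul x n f"
    unfolding g_def coord_proj_def
    by (rule biorthogonal_coord_diff_sum[OF bi insert.hyps])
  then have "f - coord_proj smul x (insert n A) f
      = g - smul (coord_functional smul x n g) (x n)"
    using insert.hyps by (simp add: g_def coord_proj_def algebra_simps)
  also have "norm \<dots> \<le> norm g"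
    using one[of n g] by (cases "n \<in> supp smul x g") (auto simp: supp_def)
  also have "\<dots> \<le> norm f"
    using insert.IH by (simp add: g_def)
  finally show ?case .
qed

theorem proposition2p1:
  fixes smul :: "'k::real_normed_field \<Rightarrow> 'a::banach \<Rightarrow> 'a"
    and x :: "nat \<Rightarrow> 'a"
  assumes "normed_space_over smul"
    and "seminormalized_Markushevich_basis smul x"
  shows "one_suppression_unconditional smul x \<longleftrightarrow>
    (\<forall>f. \<forall>n\<in>supp smul x f. norm (f - smul (coord_functional smul x n f) (x n)) \<le> norm f)"
proof
  assume unc: "one_suppression_unconditional smul x"
  have "norm (f - coord_proj smul x {n} f) \<le> norm f" for f n
    using unc by (simp add: one_suppression_unconditional_def)
  then show "\<forall>f. \<forall>n\<in>supp smul x f.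
      norm (f - smul (coord_functional smul x n f) (x n)) \<le> norm f"
    by (simp add: coord_proj_def)
next
  assume one: "\<forall>f. \<forall>n\<in>supp smul x f.
      norm (f - smul (coord_functional smul x n f) (x n)) \<le> norm f"
  have "vector_space smul"
    using assms(1) by (rule normed_space_over.axioms)
  then have "norm (f - coord_proj smul x A f) \<le> norm f" if "finite A" for A f
    using biorthogonal_coord_functional[OF assms(2)] one[rule_format] that
    by (rule norm_diff_coord_proj_le)
  then show "one_suppression_unconditional smul x"
    by (simp add: one_suppression_unconditional_def)
qed

end
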